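(* Let $b>3$ be an integer, and let $\mathcal{U}$ be an Ulam set (in an abelian group) generated by two elements $v_1$ and $v_2$ with associated lattice generated by $(-2,b)$. If $b$ is not a power of $2$, then $\mathcal{U}$ contains exactly two terms of the form $2xv_1+yv_2$ (with $x,y\in\mathbb{Z}$): $v_2$ and $(b+1)v_2=2v_1+v_2$.
   Context: Let $G$ be an abelian group (written additively) and $S=\{v_1,\dots,v_k\}\subset G$ a finite set such that $a_1v_1+\cdots+a_kv_k=0$ has no solution in nonnegative integers other than $a_1=\cdots=a_k=0$. Let $D_S$ be the set of nonempty sums of elements of $S$ (repetition allowed); then there is a size function $f:D_S\to\mathbb{R}$ with $f(x+y)>\max\{f(x),f(y)\}$ for all $x,y\in D_S$ and with $f^{-1}((-\infty,r])$ finite for all $r$. The Ulam set $\mathcal{U}(S)$ generated by $S$ is built by first putting in the elements of $S$ and then repeatedly adding a smallest (according to $f$) element of $D_S$ not already in $\mathcal{U}(S)$ that is uniquely represented as the sum of two distinct elements already in $\mathcal{U}(S)$ (with $x+y$ and $y+x$ the same representation); the resulting set does not depend on the choice of $f$ or on tie-breaking. Equivalently, an element not in $S$ is in $\mathcal{U}(S)$ iff it equals $x+y$ for exactly one unordered pair $\{x,y\}$ of distinct elements of $\mathcal{U}(S)$. The associated lattice of $\mathcal{U}(\{v_1,\dots,v_k\})$ is the subgroup of $\mathbb{Z}^k$ of all integer solutions $(x_1,\dots,x_k)$ of $x_1v_1+\cdots+x_kv_k=0$. Here $k=2$ and $v_1\ne v_2$. *)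

theory Defs
  imports
    Complex_Main
    "HOL-Library.Multiset"
    "HOL-Library.Product_Plus"
    "HOL-Computational_Algebra.Group_Closure"
begin

text \<open>Integer multiples in an additive abelian group; one of the two sums is always empty.\<close>

definition zmul :: "int \<Rightarrow> 'a::ab_group_add \<Rightarrow> 'a" (infixr "\<cdot>\<^sub>Z" 75) where
  "n \<cdot>\<^sub>Z v = (\<Sum>i<nat n. v) - (\<Sum>i<nat (- n). v)"

definition ulam_generators :: "'a::ab_group_add set \<Rightarrow> bool" where
  "ulam_generators S \<longleftrightarrow> finite S \<and>
     (\<forall>a :: 'a \<Rightarrow> nat. (\<Sum>v\<in>S. int (a v) \<cdot>\<^sub>Z v) = 0 \<longrightarrow> (\<forall>v\<in>S. a v = 0))"

text \<open>The set $D_S$ of nonempty sums of elements of $S$, repetition allowed.\<close>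

definition nonempty_sums :: "'a::ab_group_add set \<Rightarrow> 'a set" where
  "nonempty_sums S = {\<Sum>\<^sub># M | M. M \<noteq> {#} \<and> set_mset M \<subseteq> S}"

text \<open>Only the values of $f$ on $D_S$ matter.\<close>

definition size_function :: "'a::ab_group_add set \<Rightarrow> ('a \<Rightarrow> real) \<Rightarrow> bool" where
  "size_function S f \<longleftrightarrow>
     (\<forall>x\<in>nonempty_sums S. \<forall>y\<in>nonempty_sums S. f (x + y) > max (f x) (f y)) \<and>
     (\<forall>r. finite {x \<in> nonempty_sums S. f x \<le> r})"

text \<open>Representations are unordered pairs of distinct elements.\<close>

definition unique_sum :: "'a::ab_group_add set \<Rightarrow> 'a \<Rightarrow> bool" where
  "unique_sum A z \<longleftrightarrow> (\<exists>!P. \<exists>x y. P = {x, y} \<and> x \<in> A \<and> y \<in> A \<and> x \<noteq> y \<and> z = x + y)"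

definition ulam_candidates :: "'a::ab_group_add set \<Rightarrow> 'a set \<Rightarrow> 'a set" where
  "ulam_candidates S A = {z \<in> nonempty_sums S. z \<notin> A \<and> unique_sum A z}"

text \<open>
  A run of the construction: stage \<open>n\<close> is the set obtained after \<open>n\<close> additions.  Ties between
  smallest candidates are broken arbitrarily, so a run is a relation and not a function.
  If no candidate is left the run stays constant.
\<close>

definition ulam_run :: "'a::ab_group_add set \<Rightarrow> ('a \<Rightarrow> real) \<Rightarrow> (nat \<Rightarrow> 'a set) \<Rightarrow> bool" where
  "ulam_run S f A \<longleftrightarrow> A 0 = S \<and>
     (\<forall>n. if ulam_candidates S (A n) = {} then A (Suc n) = A n
          else \<exists>z\<in>ulam_candidates S (A n).
                 (\<forall>w\<in>ulam_candidates S (A n). f z \<le> f w) \<and> A (Suc n) = insert z (A n))"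

text \<open>
  \<open>U\<close> is an Ulam set generated by \<open>S\<close> if it results from some size function and some
  tie-breaking (the outcome does not depend on either).
\<close>

definition ulam_set :: "'a::ab_group_add set \<Rightarrow> 'a set \<Rightarrow> bool" where
  "ulam_set S U \<longleftrightarrow> ulam_generators S \<and>
     (\<exists>f A. size_function S f \<and> ulam_run S f A \<and> U = (\<Union>n. A n))"

definition associated_lattice :: "'a::ab_group_add \<Rightarrow> 'a \<Rightarrow> (int \<times> int) set" where
  "associated_lattice v1 v2 = {(x1, x2). x1 \<cdot>\<^sub>Z v1 + x2 \<cdot>\<^sub>Z v2 = 0}"

end

theory Submission
  imports Defs "HOL-Computational_Algebra.Primes"
begin

text \<open>
  The lattice says that \<open>2 v1 = b v2\<close> generates all relations, so every sum of generators is
  either \<open>n v2\<close> with \<open>n \<ge> 1\<close> or \<open>v1 + n v2\<close> with \<open>n \<ge> 0\<close>, for a unique \<open>n\<close>.  The terms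
  \<open>2 x v1 + y v2\<close> are those of the first kind, the even coset.

  As long as \<open>v2\<close> and \<open>(b + 1) v2\<close> are the only even terms, \<open>v1 + n v2\<close> with \<open>n \<ge> 1\<close> belongs to the
  Ulam set iff exactly one of \<open>v1 + (n - 1) v2\<close> and \<open>v1 + (n - b - 1) v2\<close> does.  The odd terms are thus the
  output \<open>r\<close> of a linear shift register over GF(2): \<open>r n\<close> is the coefficient of \<open>x^n\<close> in
  \<open>1 / (1 + x + x^(b + 1))\<close>.  Conversely, two odd terms with coordinates \<open>p\<close> and \<open>q\<close> add up to
  \<open>(b + p + q) v2\<close>, so no further even term appears provided that no \<open>m \<ge> 3\<close> is the sum of exactly
  one pair \<open>p < q\<close> of ones of the register.  Here \<open>m = 1\<close> gives \<open>(b + 1) v2\<close>, and \<open>m = 2\<close> gives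
  \<open>(b + 2) v2\<close>, which is also \<open>v2 + (b + 1) v2\<close>.  The two directions support each other in one
  induction (\<open>ulam_coordinates\<close>), and the whole weight of the proof is on the combinatorial
  statement \<open>second_pair\<close> about the register.

  Suppose that \<open>m = p + q\<close> is the only such pair.  For \<open>m \<le> 2 b + 1\<close> two pairs are visible at once, so
  let \<open>m\<close> be larger.  Since \<open>r\<close> is \<open>1\<close> on \<open>{0..b}\<close>, each one in the window \<open>{m - b..m}\<close> belongs to a
  pair with sum \<open>m\<close>, so there is at most one of them.  There is at least one, because \<open>b + 1\<close>
  consecutive zeros would be the zero state of the register.  So \<open>p \<le> b\<close>, and the window is the unit
  vector at \<open>q\<close>, from which the register can be run backwards.
  \<^item> If \<open>p > 0\<close>, running back gives ones at \<open>q - b\<close> and \<open>q - b - 1\<close>, while exactly one of \<open>p + b\<close> and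
    \<open>p + b + 1\<close> is a one because \<open>r p\<close> is their sum.  This yields another pair with sum \<open>m\<close>, up to a few
    coincidences that happen only for \<open>m \<le> 4 b + 2\<close> and contradict the explicit start of the
    register.
  \<^item> If \<open>p = 0\<close>, write \<open>b = Q c\<close> with \<open>Q\<close> a power of \<open>2\<close> and \<open>c\<close> odd.  As \<open>b\<close> is not a power of \<open>2\<close>,
    \<open>c \<ge> 3\<close>.  Raising \<open>1 + x + x^(b + 1)\<close> to the power \<open>Q\<close> gives the recurrence
    \<open>r n = r (n - Q) + r (n - Q (b + 1))\<close>.  With it one finds a second pair at one of the two
    positions \<open>(Q + 1) b + 1\<close> and \<open>(Q + 1) (b + 1)\<close>.

  All this uses of the construction only that a sum of generators which is not itself a generator
  lies in the Ulam set iff it is the sum of exactly one pair of distinct elements of that set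
  (\<open>ulam_set_iff_unique_sum\<close>).
\<close>

section \<open>Ulam sets as solutions of the unique-sum equation\<close>

lemma nonempty_sums_generator: "v \<in> S \<Longrightarrow> v \<in> nonempty_sums S"
  unfolding nonempty_sums_def by (intro CollectI exI[of _ "{#v#}"]) auto

lemma nonempty_sums_add:
  assumes "x \<in> nonempty_sums S" "y \<in> nonempty_sums S"
  shows "x + y \<in> nonempty_sums S"
proof -
  obtain M N where "x = \<Sum>\<^sub># M" "y = \<Sum>\<^sub># N" "M \<noteq> {#}" "set_mset M \<subseteq> S" "set_mset N \<subseteq> S"
    using assms unfolding nonempty_sums_def by blast
  then show ?thesis
    unfolding nonempty_sums_def by (intro CollectI exI[of _ "M + N"]) auto
qed

lemma unique_sum_cong:
  assumes "A \<subseteq> B"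
    and "\<And>x y. x \<in> B \<Longrightarrow> y \<in> B \<Longrightarrow> x \<noteq> y \<Longrightarrow> z = x + y \<Longrightarrow> x \<in> A \<and> y \<in> A"
  shows "unique_sum A z \<longleftrightarrow> unique_sum B z"
proof -
  have "(\<exists>x y. P = {x, y} \<and> x \<in> A \<and> y \<in> A \<and> x \<noteq> y \<and> z = x + y) \<longleftrightarrow>
      (\<exists>x y. P = {x, y} \<and> x \<in> B \<and> y \<in> B \<and> x \<noteq> y \<and> z = x + y)" for P
    using assms by blast
  then show ?thesis by (simp add: unique_sum_def)
qed

lemma unique_sum_pair_unique:
  assumes "unique_sum A z"
    and "x \<in> A" "y \<in> A" "x \<noteq> y" "z = x + y"
    and "x' \<in> A" "y' \<in> A" "x' \<noteq> y'" "z = x' + y'"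
  shows "{x, y} = {x', y'}"
  using assms unfolding unique_sum_def by blast

context
  fixes S :: "'a::ab_group_add set" and f :: "'a \<Rightarrow> real" and A :: "nat \<Rightarrow> 'a set"
  assumes size: "size_function S f" and run: "ulam_run S f A"
begin

lemma run_step:
  "A (Suc n) = A n \<and> ulam_candidates S (A n) = {} \<or>
   (\<exists>z\<in>ulam_candidates S (A n). (\<forall>w\<in>ulam_candidates S (A n). f z \<le> f w) \<and>
      A (Suc n) = insert z (A n))"
  using run unfolding ulam_run_def by metis

lemma run_mono: "m \<le> n \<Longrightarrow> A m \<subseteq> A n"
  by (rule lift_Suc_mono_le) (use run_step in blast)+

lemma run_subset_sums: "A n \<subseteq> nonempty_sums S"
proof (induction n)
  case 0
  then show ?case using run nonempty_sums_generator by (auto simp: ulam_run_def)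
next
  case (Suc n)
  then show ?case using run_step[of n] by (auto simp: ulam_candidates_def)
qed

lemma size_less:
  assumes "x \<in> nonempty_sums S" "y \<in> nonempty_sums S"
  shows "f x < f (x + y)" "f y < f (x + y)"
  using size assms unfolding size_function_def by auto

text \<open>
  A candidate that appears only after \<open>x\<close> has been added has \<open>x\<close> as a summand, so it is larger than
  \<open>x\<close>.  Hence the run never returns below a bound that all its candidates once satisfied.
\<close>

lemma run_late_large:
  assumes bound: "\<And>w. w \<in> ulam_candidates S (A k) \<Longrightarrow> c \<le> f w" and "k \<le> m"
  shows "(\<forall>x\<in>A m - A k. c \<le> f x) \<and> (\<forall>w\<in>ulam_candidates S (A m). c \<le> f w)"
  using \<open>k \<le> m\<close>
proof (induction m rule: dec_induct)
  case base
  then show ?case using bound by simp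
next
  case (step m)
  consider "A (Suc m) = A m" | x where "x \<in> ulam_candidates S (A m)" "A (Suc m) = insert x (A m)"
    using run_step[of m] by blast
  then show ?case
  proof cases
    case 1
    then show ?thesis using step.IH by simp
  next
    case 2
    then have x: "c \<le> f x" "x \<in> nonempty_sums S"
      using step.IH by (auto simp: ulam_candidates_def)
    have "c \<le> f w" if w: "w \<in> ulam_candidates S (A (Suc m))" for w
    proof (rule ccontr)
      assume less: "\<not> c \<le> f w"
      have "u \<in> A m \<and> v \<in> A m"
        if uv: "u \<in> A (Suc m)" "v \<in> A (Suc m)" "u \<noteq> v" "w = u + v" for u v
      proof -
        have "u \<in> nonempty_sums S" "v \<in> nonempty_sums S" using uv run_subset_sums by auto
        then have "f u < f w" "f v < f w" using size_less uv by auto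
        then show ?thesis using uv 2 x less by auto
      qed
      then have "unique_sum (A m) w \<longleftrightarrow> unique_sum (A (Suc m)) w"
        by (intro unique_sum_cong run_mono) auto
      then have "w \<in> ulam_candidates S (A m)"
        using w 2 by (auto simp: ulam_candidates_def)
      then show False using step.IH less by auto
    qed
    then show ?thesis using step.IH 2 x by auto
  qed
qed

text \<open>
  The summands of \<open>z\<close> are smaller than \<open>z\<close>, and everything that is added from \<open>z\<close> on is at least as large
  as \<open>z\<close>.  So the representations of \<open>z\<close> in the final set are those that existed when \<open>z\<close> was added.
\<close>

lemma run_member_unique_sum:
  assumes "z \<in> A n" "z \<notin> S"
  shows "unique_sum (\<Union>n. A n) z"
proof -
  define m where "m = (LEAST n. z \<in> A n)"
  have m: "z \<in> A m" unfolding m_def using assms(1) by (rule LeastI)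
  have "A 0 = S" using run by (simp add: ulam_run_def)
  then have "m \<noteq> 0" using m assms(2) by (intro notI) simp
  then obtain k where k: "m = Suc k" by (cases m) auto
  have "z \<notin> A k" using not_less_Least[of k "\<lambda>n. z \<in> A n"] k by (auto simp: m_def)
  then have z: "z \<in> ulam_candidates S (A k)" "\<And>w. w \<in> ulam_candidates S (A k) \<Longrightarrow> f z \<le> f w"
    using run_step[of k] m k by auto
  have early: "u \<in> A k" if "u \<in> A i" "f u < f z" for u i
    using run_late_large[of k "f z" "max i k", OF z(2)] that run_mono[of i "max i k"] by force
  have "unique_sum (A k) z \<longleftrightarrow> unique_sum (\<Union>n. A n) z"
  proof (rule unique_sum_cong)
    fix x y assume xy: "x \<in> (\<Union>n. A n)" "y \<in> (\<Union>n. A n)" "z = x + y"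
    then have "x \<in> nonempty_sums S" "y \<in> nonempty_sums S" using run_subset_sums by auto
    then show "x \<in> A k \<and> y \<in> A k" using size_less xy early by auto
  qed auto
  then show ?thesis using z(1) by (simp add: ulam_candidates_def)
qed

text \<open>
  If \<open>z\<close> were never added, it would remain a candidate from the stage at which its two summands are
  present.  Each later step would then add a new element of size at most \<open>f z\<close>, but there are only
  finitely many of those.
\<close>

lemma run_unique_sum_member:
  assumes "z \<in> nonempty_sums S" "unique_sum (\<Union>n. A n) z"
  shows "z \<in> (\<Union>n. A n)"
proof (rule ccontr)
  assume z: "z \<notin> (\<Union>n. A n)"
  obtain x y i j where xy: "x \<in> A i" "y \<in> A j" "x \<noteq> y" "z = x + y"
    using assms(2) unfolding unique_sum_def by blast
  define n where "n = max i j"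
  have xy': "x \<in> A m" "y \<in> A m" if "m \<ge> n" for m
    using xy run_mono[of i m] run_mono[of j m] that by (auto simp: n_def)
  have cand: "z \<in> ulam_candidates S (A m)" if "m \<ge> n" for m
  proof -
    have "unique_sum (A m) z \<longleftrightarrow> unique_sum (\<Union>n. A n) z"
    proof (rule unique_sum_cong)
      fix u v assume "u \<in> (\<Union>n. A n)" "v \<in> (\<Union>n. A n)" "u \<noteq> v" "z = u + v"
      then have "{u, v} = {x, y}"
        by (intro unique_sum_pair_unique[OF assms(2)]) (use xy in blast)+
      then show "u \<in> A m \<and> v \<in> A m" using xy'[OF that] by (auto simp: doubleton_eq_iff)
    qed auto
    then show ?thesis using assms z by (auto simp: ulam_candidates_def)
  qed
  define F where "F = {u \<in> nonempty_sums S. f u \<le> f z}"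
  have F: "finite F" using size by (simp add: F_def size_function_def)
  have "A (n + i) - A n \<subseteq> F \<and> card (A (n + i) - A n) = i" for i
  proof (induction i)
    case (Suc i)
    obtain w where w: "w \<in> ulam_candidates S (A (n + i))" "f w \<le> f z"
      "A (Suc (n + i)) = insert w (A (n + i))"
      using run_step[of "n + i"] cand[of "n + i"] by auto
    have wn: "w \<notin> A (n + i)" "w \<in> F" using w by (auto simp: ulam_candidates_def F_def)
    then have "w \<notin> A n" using run_mono[of n "n + i"] by auto
    then have "A (n + Suc i) - A n = insert w (A (n + i) - A n)" using w by auto
    moreover have "finite (A (n + i) - A n)" using Suc F finite_subset by blast
    ultimately show ?case using Suc wn by simp
  qed simp
  then have "i \<le> card F" for i using card_mono[OF F] by metis
  then show False using not_less_eq_eq by blast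
qed

end

theorem ulam_set_generators: "ulam_set S U \<Longrightarrow> S \<subseteq> U"
  unfolding ulam_set_def ulam_run_def by blast

theorem ulam_set_subset_sums: "ulam_set S U \<Longrightarrow> U \<subseteq> nonempty_sums S"
  unfolding ulam_set_def using run_subset_sums by blast

text \<open>
  This frees Ulam sets from the size function and from the order of construction.
\<close>

theorem ulam_set_iff_unique_sum:
  assumes "ulam_set S U" "z \<in> nonempty_sums S" "z \<notin> S"
  shows "z \<in> U \<longleftrightarrow> unique_sum U z"
proof -
  obtain f A where f: "size_function S f" and A: "ulam_run S f A" and U: "U = (\<Union>n. A n)"
    using assms(1) unfolding ulam_set_def by blast
  show ?thesis
    using run_member_unique_sum[OF f A _ assms(3)] run_unique_sum_member[OF f A assms(2)]
    unfolding U by blast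
qed

section \<open>Integer multiples and cyclic lattices\<close>

lemma sum_const_add:
  fixes v :: "'a::ab_group_add" and k l :: nat
  shows "(\<Sum>i<k + l. v) = (\<Sum>i<k. v) + (\<Sum>i<l. v)"
  by (induction l) (auto simp: add.assoc)

lemma zmul_of_nat_diff: "(int m - int n) \<cdot>\<^sub>Z v = (\<Sum>i<m. v) - (\<Sum>i<n. v)"
proof (cases "n \<le> m")
  case True
  then show ?thesis
    using sum_const_add[where k = "m - n" and l = n and v = v]
    by (simp add: zmul_def nat_diff_distrib)
next
  case False
  then show ?thesis
    using sum_const_add[where k = "n - m" and l = m and v = v]
    by (simp add: zmul_def nat_diff_distrib)
qed

lemma zmul_add: "(m + n) \<cdot>\<^sub>Z v = m \<cdot>\<^sub>Z v + n \<cdot>\<^sub>Z v"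
proof -
  obtain a c d e where "m = int a - int c" "n = int d - int e" using int_diff_cases by metis
  moreover have "int a - int c + (int d - int e) = int (a + d) - int (c + e)" by simp
  ultimately show ?thesis
    by (simp only: zmul_of_nat_diff sum_const_add) (simp add: algebra_simps)
qed

lemma zmul_0 [simp]: "0 \<cdot>\<^sub>Z v = 0" and zmul_1 [simp]: "1 \<cdot>\<^sub>Z v = v"
  by (simp_all add: zmul_def)

lemma zmul_minus: "(- n) \<cdot>\<^sub>Z v = - (n \<cdot>\<^sub>Z v)"
  by (simp add: zmul_def)

lemma zmul_diff: "(m - n) \<cdot>\<^sub>Z v = m \<cdot>\<^sub>Z v - n \<cdot>\<^sub>Z v"
  using zmul_add[of "m - n" n v] by simp

lemma zmul_2: "2 \<cdot>\<^sub>Z v = v + v"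
  using zmul_add[of 1 1 v] by simp

lemma group_closure_single:
  assumes "x \<in> group_closure {(s, t)}"
  shows "\<exists>k::int. x = (k * s, k * t)"
  using assms
proof (induction rule: group_closure.induct)
  case (base x)
  then show ?case by (auto simp: zero_prod_def intro: exI[of _ 0] exI[of _ 1])
next
  case (diff x y)
  then obtain k l where "x = (k * s, k * t)" "y = (l * s, l * t)" by blast
  then show ?case by (intro exI[of _ "k - l"]) (simp add: algebra_simps)
qed

section \<open>The binary register\<close>

text \<open>
  The coefficients of \<open>1 / (1 + x + x^(b + 1))\<close> over GF(2), extended by zero to negative indices so
  that the recurrence needs no special case for indices below \<open>b + 1\<close>.  The test \<open>b < 0\<close> serves
  termination.
\<close>

function register :: "int \<Rightarrow> int \<Rightarrow> bool" where
  "register b n = (if n \<le> 0 \<or> b < 0 then n = 0 else register b (n - 1) \<noteq> register b (n - b - 1))"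
  by auto
termination by (relation "measure (\<lambda>(b, n). nat n)") auto

declare register.simps [simp del]

context
  fixes b :: int
  assumes b: "b > 3"
begin

abbreviation (input) r :: "int \<Rightarrow> bool" where
  "r \<equiv> register b"

lemma register_neg: "n < 0 \<Longrightarrow> \<not> r n"
  by (simp add: register.simps)

lemma register_0: "r 0"
  by (simp add: register.simps)

lemma register_step: "n \<ge> 1 \<Longrightarrow> r n \<longleftrightarrow> (r (n - 1) \<noteq> r (n - b - 1))"
  using b by (subst register.simps) auto

text \<open>
  The recurrence read backwards.  It reaches down to \<open>- b\<close>: the values at negative indices are zero, so
  a one produced in this way can only sit at a nonnegative index.
\<close>

lemma register_up: "n \<ge> - b \<Longrightarrow> r n \<longleftrightarrow> (r (n + b) \<noteq> r (n + b + 1))"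
  using register_step[of "n + b + 1"] by auto

lemma register_head: 
  assumes "0 \<le> n" "n \<le> b"
  shows "r n"
  using assms
proof (induction n rule: int_ge_induct)
  case base
  show ?case by (rule register_0)
next
  case (step n)
  then show ?case using register_step[of "n + 1"] register_neg[of "n - b"] by simp
qed

lemma register_second_row:
  assumes "b + 1 \<le> n" "n \<le> 2 * b + 1"
  shows "r n \<longleftrightarrow> even (n - b)"
  using assms
proof (induction n rule: int_ge_induct)
  case base
  then show ?case using b register_step[of "b + 1"] register_0 register_head[of b] by simp
next
  case (step n)
  then show ?case using b register_step[of "n + 1"] register_head[of "n - b"] by auto
qed

text \<open>
  Otherwise the register would be in its zero state, and running it backwards the one at \<open>0\<close> could
  never arise.  The induction moves the window to the right.
\<close>

lemma register_window:
  assumes "n \<ge> 0"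
  shows "\<exists>i. n \<le> i \<and> i \<le> n + b \<and> r i"
  using assms
proof (induction n rule: int_ge_induct)
  case base
  then show ?case using register_0 b by force
next
  case (step n)
  then obtain i where i: "n \<le> i" "i \<le> n + b" "r i" by blast
  show ?case
  proof (cases "i = n")
    case True
    then have "r (n + b) \<or> r (n + b + 1)" using i register_up[of n] b step by auto
    then obtain j where "j = n + b \<or> j = n + b + 1" "r j" by blast
    then show ?thesis using b by (intro exI[of _ j]) auto
  next
    case False
    then show ?thesis using i by (intro exI[of _ i]) auto
  qed
qed

text \<open>
  With \<open>P = 1 + x + x^(b + 1)\<close> and \<open>q = 2 ^ k\<close>, the series times \<open>P ^ q = 1 + x^q + x^(q (b + 1))\<close> is the
  polynomial \<open>P ^ (q - 1)\<close>.  The bound on \<open>n\<close> is the first exponent beyond its degree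
  \<open>(q - 1) (b + 1)\<close>.  The induction applies the recurrence twice; the mixed terms cancel.
\<close>

lemma register_frobenius:
  fixes k :: nat
  assumes "n \<ge> 2 ^ k * (b + 1) - b"
  shows "r n \<longleftrightarrow> (r (n - 2 ^ k) \<noteq> r (n - 2 ^ k * (b + 1)))"
  using assms
proof (induction k arbitrary: n)
  case 0
  then show ?case using register_step[of n] by (simp add: algebra_simps)
next
  case (Suc k)
  define q :: int where "q = 2 ^ k"
  have "q \<ge> 1" by (simp add: q_def)
  then have "q * b \<ge> 1 * b" using b by (intro mult_right_mono) auto
  moreover have split: "q * (b + 1) = q * b + q" "2 ^ Suc k = 2 * q"
    "2 ^ Suc k * (b + 1) = 2 * (q * b) + 2 * q"
    by (simp_all add: q_def algebra_simps)
  ultimately have n: "n \<ge> 2 * (q * b) + 2 * q - b" "q * b \<ge> b" using Suc.prems by linarith+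
  note IH = Suc.IH[folded q_def]
  have "r n \<longleftrightarrow> (r (n - q) \<noteq> r (n - q * (b + 1)))"
    by (rule IH) (use n b \<open>q \<ge> 1\<close> split in linarith)
  moreover have "r (n - q) \<longleftrightarrow> (r (n - q - q) \<noteq> r (n - q - q * (b + 1)))"
    by (rule IH) (use n b \<open>q \<ge> 1\<close> split in linarith)
  moreover have "r (n - q * (b + 1)) \<longleftrightarrow>
      (r (n - q * (b + 1) - q) \<noteq> r (n - q * (b + 1) - q * (b + 1)))"
    by (rule IH) (use n b \<open>q \<ge> 1\<close> split in linarith)
  moreover have "n - q * (b + 1) - q = n - q - q * (b + 1)"
    "n - q - q = n - 2 ^ Suc k"
    "n - q * (b + 1) - q * (b + 1) = n - 2 ^ Suc k * (b + 1)"
    using split by linarith+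
  ultimately show ?case by metis
qed

lemma register_frobenius_up:
  fixes k :: nat
  assumes "n \<ge> - b"
  shows "r n \<longleftrightarrow> (r (n + 2 ^ k * b) \<noteq> r (n + 2 ^ k * (b + 1)))"
  using register_frobenius[of k "n + 2 ^ k * (b + 1)"] assms by (auto simp: algebra_simps)

text \<open>
  For \<open>P = 1 + x + x^(b + 1)\<close> one has \<open>1 / P = P / P(x^2)\<close>, and when \<open>b + 1\<close> is odd the even part of the
  numerator \<open>P\<close> is \<open>1\<close>.  So the even-indexed values repeat the whole series.
\<close>

lemma register_double:
  assumes "even b"
  shows "r (2 * n) \<longleftrightarrow> r n"
proof (induction "nat n" arbitrary: n rule: less_induct)
  case less
  consider "n < 0" | "0 \<le> n" "2 * n \<le> b" | "0 \<le> n" "2 * n \<ge> b + 2"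
    using assms by fastforce
  then show ?case
  proof cases
    case 1
    then show ?thesis by (simp add: register_neg)
  next
    case 2
    then show ?thesis by (simp add: register_head)
  next
    case 3
    have "r (2 * n) \<longleftrightarrow> (r (2 * (n - 1)) \<noteq> r (2 * (n - b - 1)))"
      using register_frobenius[of 1 "2 * n"] 3 by (simp add: algebra_simps)
    also have "\<dots> \<longleftrightarrow> (r (n - 1) \<noteq> r (n - b - 1))"
      using less[of "n - 1"] less[of "n - b - 1"] 3 b by simp
    also have "\<dots> \<longleftrightarrow> r n"
      using register_step[of n] 3 b by simp
    finally show ?thesis .
  qed
qed

lemma register_scale:
  fixes k :: nat
  assumes "2 ^ k dvd b"
  shows "r (2 ^ k * n) \<longleftrightarrow> r n"
  using assms
proof (induction k)
  case (Suc k)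
  have "even b" using Suc.prems by (meson dvd_power dvd_trans zero_less_Suc)
  then have "r (2 ^ Suc k * n) \<longleftrightarrow> r (2 ^ k * n)"
    using register_double[of "2 ^ k * n"] by (simp add: mult.assoc)
  moreover have "2 ^ k dvd b" using Suc.prems by (meson dvd_trans le_imp_power_dvd lessI less_imp_le)
  ultimately show ?case using Suc.IH by simp
qed simp

section \<open>Second representations in the register\<close>

text \<open>
  Here \<open>r\<close> is known explicitly: ones up to \<open>b\<close>, then alternating.  In every case two different pairs
  with sum \<open>m\<close> can be named, and at least one of them is not the pair of \<open>p\<close> and \<open>m - p\<close>.
\<close>

lemma second_pair_small:
  assumes "3 \<le> m" "m \<le> 2 * b + 1"
  shows "\<exists>j. j \<noteq> p \<and> j \<noteq> m - p \<and> 2 * j \<noteq> m \<and> r j \<and> r (m - j)"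
proof -
  have *: ?thesis if "0 \<le> i" "i < j" "2 * j < m" "r i" "r (m - i)" "r j" "r (m - j)" for i j
  proof (cases "i = p \<or> i = m - p")
    case True
    then show ?thesis using that by (intro exI[of _ j]) auto
  next
    case False
    then show ?thesis using that by (intro exI[of _ i]) auto
  qed
  consider "m \<le> b" | "m = b + 1" | "m \<ge> b + 2" "even (m - b)" | "m \<ge> b + 2" "odd (m - b)"
    by linarith
  then show ?thesis
  proof cases
    case 1
    show ?thesis by (rule *[of 0 1]) (use 1 assms in \<open>auto intro: register_head\<close>)
  next
    case 2
    show ?thesis by (rule *[of 1 2]) (use 2 b in \<open>auto intro: register_head\<close>)
  next
    case 3
    have "r m" using register_second_row[of m] 3 assms by simp
    moreover have "r (m - 2)"
    proof (cases "m = b + 2")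
      case True
      then show ?thesis using register_head[of b] b by simp
    next
      case False
      then have "b + 1 \<le> m - 2" using 3 by linarith
      then show ?thesis using register_second_row[of "m - 2"] 3 assms by simp
    qed
    ultimately show ?thesis
      by (intro *[of 0 2]) (use 3 b in \<open>auto intro: register_head\<close>)
  next
    case 4
    then have "m \<ge> b + 3" using b by (cases "m = b + 2") auto
    have "r (m - 1)" using register_second_row[of "m - 1"] 4 assms by simp
    moreover have "r (m - 3)"
    proof (cases "m = b + 3")
      case True
      then show ?thesis using register_head[of b] b by simp
    next
      case False
      then have "b + 1 \<le> m - 3" using \<open>m \<ge> b + 3\<close> by linarith
      then show ?thesis using register_second_row[of "m - 3"] 4 assms by simp
    qed
    ultimately show ?thesis
      by (intro *[of 1 3]) (use 4 b \<open>m \<ge> b + 3\<close> in \<open>auto intro: register_head\<close>)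
  qed
qed

text \<open>
  The window is the unit vector at \<open>q = m - p\<close>.  It determines \<open>r\<close> on the \<open>b\<close> preceding places, where only
  \<open>q - b\<close> and \<open>q - b - 1\<close> are ones.  Their partners are \<open>p + b\<close> and \<open>p + b + 1\<close>, and since \<open>r p\<close> is the
  sum of the values there, one of these is a one.  It gives a pair other than \<open>{p, q}\<close> unless it
  equals \<open>q\<close> or \<open>m / 2\<close>; this fixes \<open>m\<close> as one of four functions of \<open>p\<close>, each of which is refuted.
\<close>

lemma second_pair_positive:
  assumes p: "1 \<le> p" "p \<le> b" and m: "m \<ge> 2 * b + 2"
    and window: "\<And>i. m - b \<le> i \<Longrightarrow> i \<le> m \<Longrightarrow> r i \<longleftrightarrow> i = m - p"
  shows "\<exists>j. j \<noteq> p \<and> j \<noteq> m - p \<and> 2 * j \<noteq> m \<and> r j \<and> r (m - j)"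
proof (rule ccontr)
  assume no: "\<not> ?thesis"
  define q where "q = m - p"
  have q: "m - b \<le> q" "q + 1 \<le> m" "m = p + q" using p by (auto simp: q_def)
  have w: "r i \<longleftrightarrow> i = q" if "m - b \<le> i" "i \<le> m" for i
    using window[OF that] by (simp add: q_def)
  have before: "r n \<longleftrightarrow> n = q - b \<or> n = q - b - 1" if "m - 2 * b \<le> n" "n \<le> m - b - 1" for n
    using register_up[of n] w[of "n + b"] w[of "n + b + 1"] that m b by auto
  have q1: "r (q - b)"
    using register_up[of "q - b"] w[of q] w[of "q + 1"] q m by simp
  have "\<not> r (q - 1)"
  proof (cases "p = b")
    case True
    then show ?thesis
      using register_up[of "q - 1"] w[of "m - 1"] w[of m] q m b by (simp add: algebra_simps)
  next
    case False
    then show ?thesis using w[of "q - 1"] q p by simp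
  qed
  then have q2: "r (q - b - 1)"
    using register_up[of "q - b - 1"] w[of q] q m by simp
  have "r p" using p by (intro register_head) auto
  then have "r (p + b) \<noteq> r (p + b + 1)" using register_up[of p] p by auto
  then obtain j where j: "j = p + b \<or> j = p + b + 1" "r j" by blast
  have "m - j = q - b \<or> m - j = q - b - 1" using j(1) q by auto
  then have "r (m - j)" using q1 q2 by auto
  then have "j = m - p \<or> 2 * j = m" using no j p b by auto
  then consider "m = 2 * p + b" | "m = 2 * p + b + 1"
    | "m = 2 * p + 2 * b" "r (p + b)" | "m = 2 * p + 2 * b + 2" "r (p + b + 1)"
    using j by force
  then show False
  proof cases
    case 1
    have "\<not> p + 1 \<le> b"
      using before[of "p + 1"] register_head[of "p + 1"] 1 p m by (auto simp: q_def)
    then have "p = b" using p by linarith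
    then show False
      using before[of "b + 2"] register_second_row[of "b + 2"] 1 b by (auto simp: q_def)
  next
    case 2
    have "\<not> p \<le> b - 2"
      using before[of "p - 1"] register_head[of "p - 1"] 2 p m by (auto simp: q_def)
    then show False
      using before[of "b + 2"] register_second_row[of "b + 2"] 2 b p by (auto simp: q_def)
  next
    case 3
    then show False
      using q2 register_up[of "p - 1"] register_head[of "p - 1"] p
      by (auto simp: q_def algebra_simps)
  next
    case 4
    have two: "r (p + b + 2)" using q1 4 by (simp add: q_def algebra_simps)
    \<comment> \<open>Neighbouring ones at \<open>p + b + 1\<close> and \<open>p + b + 2\<close> force \<open>r (p + 1)\<close> to vanish.\<close>
    have "p = b"
    proof (rule ccontr)
      assume "p \<noteq> b"
      then show False
        using two 4 register_up[of "p + 1"] register_head[of "p + 1"] p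
        by (auto simp: algebra_simps)
    qed
    with 4 two have m': "m = 4 * b + 2" "q = 3 * b + 2" "r (2 * b + 1)" "r (2 * b + 2)"
      by (auto simp: q_def)
    have "odd b" using register_second_row[of "2 * b + 1"] m' b by auto
    have w: "\<not> r (3 * b + 2 + i)" if "1 \<le> i" "i \<le> b" for i
      using window[of "3 * b + 2 + i"] m' that by (simp add: q_def)
    \<comment> \<open>The zeros behind \<open>q\<close> force zeros one period lower, which the one at \<open>b + 4\<close> violates.\<close>
    have lower: "\<not> r (2 * b + 1 + i)" if "2 \<le> i" "i \<le> b" for i
      using register_step[of "3 * b + 2 + i"] w[of i] w[of "i - 1"] that b
      by (simp add: algebra_simps)
    have "r (b + 4)" using register_second_row[of "b + 4"] b by simp
    then show False
      using register_step[of "2 * b + 5"] lower[of 3] lower[of 4] b by (simp add: algebra_simps)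
  qed
qed

text \<open>
  Write \<open>b = Q c\<close> with \<open>Q\<close> a power of \<open>2\<close> and \<open>c \<ge> 3\<close> odd.  A window of \<open>b\<close> zeros followed by a one
  cannot occur early, because \<open>r\<close> is \<open>1\<close> at the multiples of \<open>Q\<close> up to \<open>Q b\<close>.  The recurrence with steps
  \<open>Q\<close> and \<open>Q (b + 1)\<close>, run backwards from the window, gives ones at \<open>m - J\<close> and \<open>m - (J + Q)\<close> for
  \<open>J = (Q + 1) b + 1\<close>, and it is an identity of the register that \<open>J\<close> and \<open>J + Q\<close> are ones as well.
  The condition \<open>c \<ge> 3\<close> enters through \<open>2 Q \<le> b\<close>: it keeps the indices shifted by \<open>Q\<close> inside the
  window.
\<close>

lemma second_pair_zero:
  assumes "\<not> (\<exists>k::nat. b = 2 ^ k)" and m: "m \<ge> 2 * b + 2"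
    and window: "\<And>i. m - b \<le> i \<Longrightarrow> i \<le> m \<Longrightarrow> r i \<longleftrightarrow> i = m"
  shows "\<exists>j. j \<noteq> 0 \<and> j \<noteq> m \<and> 2 * j \<noteq> m \<and> r j \<and> r (m - j)"
proof -
  define k where "k = multiplicity 2 b"
  obtain c where bc: "b = 2 ^ k * c" and "odd c"
    unfolding k_def by (rule multiplicity_decompose'[of b 2]) (use b in auto)
  define Q :: int where "Q = 2 ^ k"
  have Q: "Q \<ge> 1" by (simp add: Q_def)
  have bQ: "b = Q * c" using bc by (simp add: Q_def)
  have "c > 0" using bQ b Q by (smt (verit) mult_nonneg_nonpos)
  moreover have "c \<noteq> 1" using assms(1) bc by auto
  moreover have "c \<noteq> 2" using \<open>odd c\<close> by auto
  ultimately have c: "c \<ge> 3" by linarith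
  have Qb: "3 * Q \<le> b" using c Q mult_left_mono[of 3 c Q] by (simp add: bQ)
  have cb: "c \<le> b" using c Q mult_right_mono[of 1 Q c] by (simp add: bQ)
  have scale: "r (Q * n) \<longleftrightarrow> r n" for n
    unfolding Q_def by (rule register_scale) (simp add: bc)
  have up: "r n \<longleftrightarrow> (r (n + Q * b) \<noteq> r (n + Q * b + Q))" if "n \<ge> - b" for n
    using register_frobenius_up[OF that, of k] by (simp add: Q_def algebra_simps)
  define J where "J = Q * b + b + 1"
  \<comment> \<open>One step back from \<open>J + Q\<close> leads to multiples of \<open>Q\<close>, where \<open>register_scale\<close> divides out \<open>Q\<close>.\<close>
  have JQ: "r (J + Q)"
  proof -
    have "r (J + Q) \<longleftrightarrow> (r (Q * (b + 1 + c)) \<noteq> r (Q * (b + 1)))"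
      using register_step[of "J + Q"] Q b by (simp add: J_def bQ algebra_simps)
    also have "\<dots> \<longleftrightarrow> (r (b + 1 + c) \<noteq> r (b + 1))" by (simp only: scale)
    also have "\<dots>"
      using register_second_row[of "b + 1 + c"] register_second_row[of "b + 1"] c cb b \<open>odd c\<close> by simp
    finally show ?thesis .
  qed
  have J: "r J"
    using up[of "b + 1"] JQ register_second_row[of "b + 1"] b by (simp add: J_def algebra_simps)
  have "m \<ge> Q * b + Q + 1"
  proof (rule ccontr)
    assume small: "\<not> ?thesis"
    define t where "t = (m - 1) div Q"
    have t: "Q * t \<le> m - 1" "m - 1 < Q * t + Q"
      using pos_mod_bound[of Q "m - 1"] pos_mod_sign[of Q "m - 1"] mult_div_mod_eq[of Q "m - 1"] Q
      unfolding t_def by linarith+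
    have "t \<le> b"
    proof (rule ccontr)
      assume "\<not> t \<le> b"
      then have "Q * (b + 1) \<le> Q * t" using Q by (intro mult_left_mono) auto
      then show False using t small by (simp add: algebra_simps)
    qed
    moreover have "t \<ge> 0" using m b Q by (simp add: t_def pos_imp_zdiv_nonneg_iff)
    ultimately have "r (Q * t)" by (simp add: scale register_head)
    then show False using window[of "Q * t"] t Qb Q by auto
  qed
  \<comment> \<open>The only one among the \<open>b\<close> places before the window.\<close>
  have last: "r (m - b - 1)" using register_up[of "m - b - 1"] window[of "m - 1"] window[of m] m b by auto
  have "r (m - J)"
    using up[of "m - J"] window[of "m - b - 1 + Q"] last \<open>m \<ge> Q * b + Q + 1\<close> Q Qb
    by (simp add: J_def algebra_simps)
  have "\<not> r (m - b - 1 - Q)" 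
    using register_up[of "m - b - 1 - Q"] window[of "m - 1 - Q"] window[of "m - Q"] Q Qb m
    by (simp add: algebra_simps)
  then have mJQ: "r (m - (J + Q))"
    using up[of "m - (J + Q)"] last \<open>m \<ge> Q * b + Q + 1\<close> Q Qb
    by (simp add: J_def algebra_simps)
  then have mge: "m \<ge> J + Q" using register_neg by force
  have "J > b" using Q b by (simp add: J_def)
  \<comment> \<open>Each of \<open>J\<close> and \<open>J + Q\<close> fails only if it equals \<open>m\<close> or \<open>m / 2\<close>; as \<open>J < J + Q < 2 J\<close>, not both do.\<close>
  show ?thesis
  proof (cases "m = J + Q \<or> m = 2 * (J + Q)")
    case True
    then show ?thesis using J \<open>r (m - J)\<close> \<open>J > b\<close> Q Qb by (intro exI[of _ J]) auto
  next
    case False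
    then show ?thesis using JQ mJQ mge \<open>J > b\<close> Q Qb b by (intro exI[of _ "J + Q"]) auto
  qed
qed

text \<open>
  The ones at \<open>0, \<dots>, b\<close> probe the window \<open>{m - b..m}\<close>: by uniqueness at most one of them has a partner
  there, and the window contains a one.  So it is a unit vector, and one of the two lemmas on such
  windows applies, according to whether the one sits at the right end.
\<close>

theorem second_pair:
  assumes pow: "\<not> (\<exists>k::nat. b = 2 ^ k)" and m: "m \<ge> 3"
    and p: "r p" "r (m - p)" "p < m - p"
  shows "\<exists>j. j \<noteq> p \<and> j \<noteq> m - p \<and> 2 * j \<noteq> m \<and> r j \<and> r (m - j)"
proof (rule ccontr)
  assume no: "\<not> ?thesis"
  have "\<not> m \<le> 2 * b + 1" using second_pair_small[of m p] m no by blast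
  then have big: "m \<ge> 2 * b + 2" by linarith
  have low: "i = p" if "0 \<le> i" "i \<le> b" "r (m - i)" for i
    using no that register_head[of i] big p register_neg by force
  obtain q where q: "m - b \<le> q" "q \<le> m" "r q" using register_window[of "m - b"] big b by auto
  then have pq: "m - q = p" by (intro low) auto
  have window: "r i \<longleftrightarrow> i = m - p" if "m - b \<le> i" "i \<le> m" for i
    using low[of "m - i"] that p by auto
  show False
  proof (cases "p = 0")
    case True
    then show False using second_pair_zero[OF pow big] window no by auto
  next
    case False
    then show False using second_pair_positive[of p m] window no big pq q by auto
  qed
qed

end

section \<open>Coordinates of the Ulam set\<close>

context
  fixes b :: int and v1 v2 :: "'a::ab_group_add"
  assumes b: "b > 3" and lattice: "associated_lattice v1 v2 = group_closure {(- 2, b)}"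
begin

text \<open>
  The two cosets of the subgroup generated by \<open>v2\<close>, named after the parity of the coefficient of \<open>v1\<close>.
\<close>

abbreviation (input) ev :: "int \<Rightarrow> 'a" where "ev n \<equiv> n \<cdot>\<^sub>Z v2"
abbreviation (input) od :: "int \<Rightarrow> 'a" where "od n \<equiv> v1 + n \<cdot>\<^sub>Z v2"

lemma relation_iff: "x \<cdot>\<^sub>Z v1 + y \<cdot>\<^sub>Z v2 = 0 \<longleftrightarrow> (x, y) \<in> group_closure {(- 2, b)}"
  unfolding lattice[symmetric] by (simp add: associated_lattice_def)

lemma double_v1: "v1 + v1 = ev b"
proof -
  have "(- 2) \<cdot>\<^sub>Z v1 + b \<cdot>\<^sub>Z v2 = 0" unfolding relation_iff by (rule group_closure.base) simp
  then show ?thesis by (simp add: zmul_minus zmul_2 algebra_simps)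
qed

lemma coset_add:
  "ev i + ev j = ev (i + j)" "ev i + od j = od (i + j)" "od i + ev j = od (i + j)"
  "od i + od j = ev (b + i + j)"
proof -
  have "od i + od j = v1 + v1 + (ev i + ev j)" by (simp add: algebra_simps)
  then show "od i + od j = ev (b + i + j)" by (simp add: double_v1 zmul_add add.assoc)
qed (simp_all add: zmul_add algebra_simps)

lemma ev_eq_iff [simp]: "ev i = ev j \<longleftrightarrow> i = j"
proof
  assume "ev i = ev j"
  then have "0 \<cdot>\<^sub>Z v1 + (i - j) \<cdot>\<^sub>Z v2 = 0" by (simp add: zmul_diff)
  then have "(0 :: int, i - j) \<in> group_closure {(- 2, b)}" unfolding relation_iff .
  from group_closure_single[OF this] show "i = j" by auto
qed simp

lemma ev_neq_od: "ev i \<noteq> od j"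
proof
  assume "ev i = od j"
  then have "1 \<cdot>\<^sub>Z v1 + (j - i) \<cdot>\<^sub>Z v2 = 0" by (simp add: zmul_diff)
  then have "(1 :: int, j - i) \<in> group_closure {(- 2, b)}" unfolding relation_iff .
  from group_closure_single[OF this] show False by (auto, presburger)
qed

lemma od_neq_ev: "od j \<noteq> ev i"
  using ev_neq_od[of i j] by simp

lemma sums_coset: "nonempty_sums {v1, v2} = ev ` {1..} \<union> od ` {0..}"
proof
  have "M \<noteq> {#} \<longrightarrow> \<Sum>\<^sub># M \<in> ev ` {1..} \<union> od ` {0..}" if "set_mset M \<subseteq> {v1, v2}" for M
    using that
  proof (induction M)
    case (add x M)
    have x: "x = od 0 \<or> x = ev 1" using add.prems by auto
    show ?case
    proof (cases "M = {#}")
      case True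
      then have "\<Sum>\<^sub># (add_mset x M) = x" by simp
      moreover have "od 0 \<in> od ` {0..}" "ev 1 \<in> ev ` {1..}" by (intro imageI; simp)+
      ultimately show ?thesis using x by (metis UnI1 UnI2)
    next
      case False
      then consider n where "n \<ge> 1" "\<Sum>\<^sub># M = ev n" | n where "n \<ge> 0" "\<Sum>\<^sub># M = od n"
        using add by auto
      then show ?thesis
        using x b by cases (elim disjE; simp only: sum_mset.add_mset coset_add; force)+
    qed
  qed simp
  then show "nonempty_sums {v1, v2} \<subseteq> ev ` {1..} \<union> od ` {0..}"
    unfolding nonempty_sums_def by blast
next
  have v: "v1 \<in> nonempty_sums {v1, v2}" "v2 \<in> nonempty_sums {v1, v2}"
    by (auto intro: nonempty_sums_generator)
  have ev: "ev n \<in> nonempty_sums {v1, v2}" if "n \<ge> 1" for n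
    using that
  proof (induction n rule: int_ge_induct)
    case (step n)
    then show ?case using nonempty_sums_add[OF step.IH v(2)] by (simp add: zmul_add)
  qed (simp add: v)
  moreover have "od n \<in> nonempty_sums {v1, v2}" if "n \<ge> 0" for n
    using nonempty_sums_add[OF v(1) ev[of n]] that v by (cases "n = 0") auto
  ultimately show "ev ` {1..} \<union> od ` {0..} \<subseteq> nonempty_sums {v1, v2}" by auto
qed

context
  fixes U :: "'a set"
  assumes U: "ulam_set {v1, v2} U" 
begin

lemma U_cases:
  assumes "x \<in> U"
  obtains i where "x = ev i" "i \<ge> 1" | i where "x = od i" "i \<ge> 0"
proof -
  have "x \<in> ev ` {1..} \<union> od ` {0..}"
    using assms ulam_set_subset_sums[OF U] unfolding sums_coset by blast
  then show thesis using that by fastforce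
qed

lemma ev_in_U_pos: "ev n \<in> U \<Longrightarrow> n \<ge> 1"
  by (erule U_cases) (simp_all add: ev_neq_od)

lemma od_in_U_nonneg: "od n \<in> U \<Longrightarrow> n \<ge> 0"
  by (erule U_cases) (simp_all add: od_neq_ev)

lemma ev_in_U_iff:
  assumes "n \<ge> 2"
  shows "ev n \<in> U \<longleftrightarrow> unique_sum U (ev n)"
proof (rule ulam_set_iff_unique_sum[OF U])
  show "ev n \<in> nonempty_sums {v1, v2}"
    unfolding sums_coset using assms by (intro UnI1 imageI) simp
  have "ev n \<noteq> v1" using ev_neq_od[of n 0] by simp
  moreover have "ev n \<noteq> v2" using ev_eq_iff[of n 1] assms by simp
  ultimately show "ev n \<notin> {v1, v2}" by simp
qed

lemma od_in_U_iff:
  assumes "n \<ge> 1"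
  shows "od n \<in> U \<longleftrightarrow> unique_sum U (od n)"
proof (rule ulam_set_iff_unique_sum[OF U])
  show "od n \<in> nonempty_sums {v1, v2}"
    unfolding sums_coset using assms by (intro UnI2 imageI) simp
  have "od n \<noteq> v1" using ev_eq_iff[of n 0] assms by simp
  moreover have "od n \<noteq> v2" using od_neq_ev[of n 1] by simp
  ultimately show "od n \<notin> {v1, v2}" by simp
qed

lemma od_sum_cases:
  assumes "x \<in> U" "y \<in> U" "od n = x + y"
  obtains i where "{x, y} = {ev i, od (n - i)}" "ev i \<in> U" "od (n - i) \<in> U"
proof -
  from assms(1) show thesis
  proof (cases rule: U_cases)
    case (1 i)
    from assms(2) show thesis
    proof (cases rule: U_cases)
      case (1 j)
      then show thesis using \<open>x = ev i\<close> assms(3) od_neq_ev by (simp add: coset_add)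
    next
      case (2 j)
      then have "n - i = j" using \<open>x = ev i\<close> assms(3) by (simp add: coset_add)
      then show thesis using that[of i] 2 \<open>x = ev i\<close> assms by auto
    qed
  next
    case (2 i)
    from assms(2) show thesis
    proof (cases rule: U_cases)
      case (1 j)
      then have "n - j = i" using \<open>x = od i\<close> assms(3) by (simp add: coset_add)
      then show thesis using that[of j] 1 \<open>x = od i\<close> assms by auto
    next
      case (2 j)
      have "od n = od i + od j" using assms(3) \<open>x = od i\<close> \<open>y = od j\<close> by simp
      then show thesis using od_neq_ev by (simp only: coset_add)
    qed
  qed
qed

lemma ex1_of_two: "c \<noteq> d \<Longrightarrow> (\<exists>!i. (i = c \<or> i = d) \<and> Q i) \<longleftrightarrow> (Q c \<noteq> Q d)"
  by auto

lemma ex1_inj_image: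
  assumes "inj g"
  shows "(\<exists>!P. \<exists>i. P = g i \<and> Q i) \<longleftrightarrow> (\<exists>!i. Q i)"
proof
  assume "\<exists>!P. \<exists>i. P = g i \<and> Q i"
  then show "\<exists>!i. Q i" using injD[OF assms] by metis
next
  assume "\<exists>!i. Q i"
  then show "\<exists>!P. \<exists>i. P = g i \<and> Q i" by blast
qed

text \<open>
  An odd sum has exactly one even and one odd summand, so its unordered representations are
  parametrised by the coordinate of the even one.
\<close>

lemma unique_sum_od: "unique_sum U (od n) \<longleftrightarrow> (\<exists>!i. ev i \<in> U \<and> od (n - i) \<in> U)"
proof -
  have "(\<exists>x y. P = {x, y} \<and> x \<in> U \<and> y \<in> U \<and> x \<noteq> y \<and> od n = x + y) \<longleftrightarrow>
      (\<exists>i. P = {ev i, od (n - i)} \<and> ev i \<in> U \<and> od (n - i) \<in> U)" (is "?L \<longleftrightarrow> ?R") for P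
  proof
    assume ?L
    then show ?R using od_sum_cases by metis
  next
    assume ?R
    then obtain i where i: "P = {ev i, od (n - i)}" "ev i \<in> U" "od (n - i) \<in> U" by blast
    then show ?L
      using ev_neq_od[of i "n - i"] coset_add(2)[of i "n - i"]
      by (intro exI[of _ "ev i"] exI[of _ "od (n - i)"]) auto
  qed
  moreover have "inj (\<lambda>i. {ev i, od (n - i)})"
    using ev_neq_od by (auto simp: inj_def doubleton_eq_iff)
  ultimately show ?thesis unfolding unique_sum_def by (simp add: ex1_inj_image)
qed

lemma ev_sum_cases:
  assumes "x \<in> U" "y \<in> U" "x \<noteq> y" "ev n = x + y"
  obtains (ev) i j where "{x, y} = {ev i, ev j}" "ev i \<in> U" "ev j \<in> U" "i < j" "i + j = n"
  | (od) i j where "{x, y} = {od i, od j}" "od i \<in> U" "od j \<in> U" "i < j" "i + j = n - b"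
proof -
  from assms(1) show thesis
  proof (cases rule: U_cases)
    case (1 i)
    from assms(2) show thesis
    proof (cases rule: U_cases)
      case (1 j)
      then have "i \<noteq> j" "i + j = n" using \<open>x = ev i\<close> assms by (auto simp: coset_add)
      then show thesis
        using that(1)[of i j] that(1)[of j i] \<open>x = ev i\<close> 1 assms by (cases "i < j") auto
    next
      case (2 j)
      have "ev n = ev i + od j" using assms(4) \<open>x = ev i\<close> \<open>y = od j\<close> by simp
      then show thesis using ev_neq_od by (simp only: coset_add)
    qed
  next
    case (2 i)
    from assms(2) show thesis
    proof (cases rule: U_cases)
      case (1 j)
      have "ev n = od i + ev j" using assms(4) \<open>x = od i\<close> \<open>y = ev j\<close> by simp
      then show thesis using ev_neq_od by (simp only: coset_add)
    next
      case (2 j)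
      have "ev n = od i + od j" using assms(4) \<open>x = od i\<close> \<open>y = od j\<close> by simp
      then have "i + j = n - b" by (simp only: coset_add ev_eq_iff)
      moreover have "i \<noteq> j" using assms \<open>x = od i\<close> 2 by auto
      ultimately show thesis
        using that(2)[of i j] that(2)[of j i] \<open>x = od i\<close> 2 assms by (cases "i < j") auto
    qed
  qed
qed

text \<open>
  Strong induction on \<open>n\<close>.  Whether \<open>ev n\<close> belongs to \<open>U\<close> depends on even coordinates below \<open>n\<close> and odd
  coordinates at most \<open>n - b\<close>; for \<open>od n\<close> it depends on even coordinates at most \<open>n\<close> and odd ones below
  \<open>n\<close>.  So the even claim for \<open>n\<close> is settled first and then used for the odd one.
\<close>

theorem ulam_coordinates:
  assumes pow: "\<not> (\<exists>k::nat. b = 2 ^ k)"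
  shows "(ev n \<in> U \<longleftrightarrow> n = 1 \<or> n = b + 1) \<and> (od n \<in> U \<longleftrightarrow> register b n)"
proof (induction "nat n" arbitrary: n rule: less_induct)
  case less
  have gens: "ev 1 \<in> U" "od 0 \<in> U" using ulam_set_generators[OF U] by auto
  have IH: "(ev i \<in> U \<longleftrightarrow> i = 1 \<or> i = b + 1) \<and> (od i \<in> U \<longleftrightarrow> register b i)" if "i < n" "n > 0" for i
    by (rule less) (use that in auto)
  have reg: "register b n \<longleftrightarrow> n = 0" if "n \<le> 0" 
    using that by (simp add: register.simps)
  have not_unique: False
    if "unique_sum U (ev n)" "od i \<in> U" "od j \<in> U" "i < j" "i + j = n - b"
      "x \<in> U" "y \<in> U" "x \<noteq> y" "x + y = ev n" "x \<noteq> od i" "x \<noteq> od j" for i j x y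
  proof -
    have "{x, y} = {od i, od j}"
      by (rule unique_sum_pair_unique) (use that coset_add(4)[of i j] in \<open>auto simp: algebra_simps\<close>)
    then show False using that by auto
  qed
  have ev: "ev n \<in> U \<longleftrightarrow> n = 1 \<or> n = b + 1"
  proof -
    consider "n \<le> 0" | "n = 1" | "2 \<le> n" "n \<le> b" | "n = b + 1" | "n = b + 2" | "n \<ge> b + 3"
      by linarith
    then show ?thesis
    proof cases
      case 1
      then show ?thesis using ev_in_U_pos[of n] b by auto
    next
      case 2
      then show ?thesis using gens by simp
    next
      case 3
      have "\<not> unique_sum U (ev n)"
      proof
        assume "unique_sum U (ev n)"
        then obtain x y where "x \<in> U" "y \<in> U" "x \<noteq> y" "ev n = x + y"
          unfolding unique_sum_def by blast
        then show False
        proof (cases rule: ev_sum_cases)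
          case (ev i j)
          then have "i \<ge> 1" using ev_in_U_pos by blast
          then show False using ev IH[of i] IH[of j] 3 by auto
        next
          case (od i j)
          then show False using od_in_U_nonneg[of i] 3 by auto
        qed
      qed
      then show ?thesis using ev_in_U_iff[of n] 3 by auto
    next
      case 4
      have "od 1 \<in> U" using IH[of 1] register_head[OF b, of 1] 4 b by simp
      have only: "{x, y} = {od 0, od 1}"
        if "x \<in> U" "y \<in> U" "x \<noteq> y" "ev n = x + y" for x y
        using that
      proof (cases rule: ev_sum_cases)
        case (ev i j)
        then have "i \<ge> 1" using ev_in_U_pos by blast
        then show ?thesis using ev IH[of i] IH[of j] 4 b by auto
      next
        case (od i j)
        then have "i = 0" "j = 1" using od_in_U_nonneg[of i] 4 by auto
        then show ?thesis using od by simp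
      qed
      have "od 0 + od 1 = ev n" using 4 by (simp only: coset_add) (simp add: add.commute)
      moreover have "od 0 \<noteq> od 1" using ev_eq_iff[of 0 1] by (simp del: ev_eq_iff)
      ultimately have "unique_sum U (ev n)"
        unfolding unique_sum_def using gens(2) \<open>od 1 \<in> U\<close> only
        by (intro ex1I[of _ "{od 0, od 1}"]) metis+
      then show ?thesis using ev_in_U_iff[of n] 4 b by simp
    next
      case 5
      have "od 2 \<in> U" "ev (b + 1) \<in> U" using IH[of 2] IH[of "b + 1"] register_head[OF b, of 2] 5 b by auto
      moreover have "ev 1 + ev (b + 1) = ev n" using 5 by (simp only: coset_add) (simp add: add.commute)
      moreover have "ev 1 \<noteq> ev (b + 1)" using b by (simp only: ev_eq_iff)
      ultimately have "\<not> unique_sum U (ev n)"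
        using not_unique[of 0 2 "ev 1" "ev (b + 1)"] gens 5 ev_neq_od[of 1 0] ev_neq_od[of 1 2] by auto
      then show ?thesis using ev_in_U_iff[of n] 5 b by simp
    next
      case 6
      have "\<not> unique_sum U (ev n)"
      proof
        assume uniq: "unique_sum U (ev n)"
        then obtain x y where "x \<in> U" "y \<in> U" "x \<noteq> y" "ev n = x + y"
          unfolding unique_sum_def by blast
        then show False
        proof (cases rule: ev_sum_cases)
          case (ev i j)
          then have "i \<ge> 1" using ev_in_U_pos by blast
          then show False using ev IH[of i] IH[of j] 6 b by auto
        next
          case (od i j)
          then have nonneg: "i \<ge> 0" "j \<ge> 0" using od_in_U_nonneg by auto
          define m where "m = n - b"
          have "register b i" "register b (m - i)" "i < m - i"
            using IH[of i] IH[of j] od nonneg 6 b by (auto simp: m_def algebra_simps)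
          then obtain k where k: "k \<noteq> i" "k \<noteq> m - i" "2 * k \<noteq> m" "register b k" "register b (m - k)"
            using second_pair[OF b pow, of m i] 6 by (auto simp: m_def)
          then have "k \<ge> 0" "m - k \<ge> 0" using register_neg[OF b] by force+
          then have kU: "od k \<in> U" "od (m - k) \<in> U"
            using IH[of k] IH[of "m - k"] k 6 b by (auto simp: m_def)
          have "od k + od (m - k) = ev n" by (simp only: coset_add) (simp add: m_def)
          then show False
            using not_unique[OF uniq od(2-5) kU] k od(5) by (auto simp: m_def)
        qed
      qed
      then show ?thesis using ev_in_U_iff[of n] 6 b by simp
    qed
  qed
  have "od n \<in> U \<longleftrightarrow> register b n"
  proof -
    consider "n < 0" | "n = 0" | "n \<ge> 1" by linarith
    then show ?thesis
    proof cases
      case 1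
      then show ?thesis using od_in_U_nonneg[of n] register_neg[OF b] by auto
    next
      case 2
      then show ?thesis using gens reg by simp
    next
      case 3
      have pairs: "ev i \<in> U \<and> od (n - i) \<in> U \<longleftrightarrow> (i = 1 \<or> i = b + 1) \<and> register b (n - i)" for i
      proof (cases "i \<ge> 1 \<and> i \<le> n")
        case True
        then show ?thesis using IH[of i] IH[of "n - i"] ev 3 by (cases "i = n") auto
      next
        case False
        then show ?thesis
          using ev_in_U_pos[of i] od_in_U_nonneg[of "n - i"] register_neg[OF b, of "n - i"] b by force
      qed
      have "unique_sum U (od n) \<longleftrightarrow> (\<exists>!i. (i = 1 \<or> i = b + 1) \<and> register b (n - i))"
        unfolding unique_sum_od pairs ..
      also have "\<dots> \<longleftrightarrow> (register b (n - 1) \<noteq> register b (n - (b + 1)))"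
        using b by (intro ex1_of_two) simp
      also have "\<dots> \<longleftrightarrow> register b n"
        using register_step[OF b, of n] 3 by (simp add: algebra_simps)
      finally show ?thesis using od_in_U_iff[of n] 3 by simp
    qed
  qed
  then show ?case using ev by blast
qed

end

lemma even_coset: "(2 * x) \<cdot>\<^sub>Z v1 + y \<cdot>\<^sub>Z v2 = ev (x * b + y)"
proof -
  have "(2 * x) \<cdot>\<^sub>Z v1 = ev (x * b)"
  proof (induction x rule: int_induct[where k = 0])
    case (step1 x)
    have "(2 * (x + 1)) \<cdot>\<^sub>Z v1 = (2 * x) \<cdot>\<^sub>Z v1 + 2 \<cdot>\<^sub>Z v1"
      by (simp only: zmul_add[symmetric]) (simp add: algebra_simps)
    then show ?case using step1 by (simp add: zmul_2 double_v1 coset_add(1) algebra_simps)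
  next
    case (step2 x)
    have "(2 * (x - 1)) \<cdot>\<^sub>Z v1 = (2 * x) \<cdot>\<^sub>Z v1 - 2 \<cdot>\<^sub>Z v1"
      by (simp only: zmul_diff[symmetric]) (simp add: algebra_simps)
    then show ?case
      using step2 by (simp add: zmul_2 double_v1 zmul_diff[symmetric] left_diff_distrib)
  qed simp
  then show ?thesis by (simp add: zmul_add)
qed

end

theorem theorem4p5:
  fixes b :: int and v1 v2 :: "'a::ab_group_add" and U :: "'a set"
  assumes "b > 3"
    and "v1 \<noteq> v2"
    and "ulam_set {v1, v2} U"
    and "associated_lattice v1 v2 = group_closure {(- 2, b)}"
    and "\<not> (\<exists>n::nat. b = 2 ^ n)"
  shows "{u \<in> U. \<exists>x y :: int. u = (2 * x) \<cdot>\<^sub>Z v1 + y \<cdot>\<^sub>Z v2} = {v2, (b + 1) \<cdot>\<^sub>Z v2}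
    \<and> v2 \<noteq> (b + 1) \<cdot>\<^sub>Z v2
    \<and> (b + 1) \<cdot>\<^sub>Z v2 = 2 \<cdot>\<^sub>Z v1 + v2"
proof (intro conjI)
  note coset = even_coset[OF assms(1,4)]
  have "(\<exists>x y :: int. u = (2 * x) \<cdot>\<^sub>Z v1 + y \<cdot>\<^sub>Z v2) \<longleftrightarrow> (\<exists>n. u = n \<cdot>\<^sub>Z v2)" for u
    unfolding coset by (metis add_0 mult_zero_left)
  then show "{u \<in> U. \<exists>x y :: int. u = (2 * x) \<cdot>\<^sub>Z v1 + y \<cdot>\<^sub>Z v2} = {v2, (b + 1) \<cdot>\<^sub>Z v2}"
    using ulam_coordinates[OF assms(1,4,3,5)] zmul_1[of v2] by (auto simp del: zmul_1) metis+
  show "v2 \<noteq> (b + 1) \<cdot>\<^sub>Z v2"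
    using ev_eq_iff[OF assms(1,4), of 1 "b + 1"] assms(1) by simp
  show "(b + 1) \<cdot>\<^sub>Z v2 = 2 \<cdot>\<^sub>Z v1 + v2"
    using coset[of 1 1] by simp
qed

end
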